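(* Let $S$ be a semigroup which is a disjoint union of finitely many copies of the free monogenic semigroup, i.e. $S=\bigsqcup_{a\in A}N_a$, where $A\subset S$ is a finite set and, for each $a\in A$, $N_a=\langle a\rangle=\{a^i: i\in\mathbb{Z}_{>0}\}$ is a subsemigroup isomorphic to $(\mathbb{Z}_{>0},+)$. Let $\overline{S}=\{1\}\cup S$ be the monoid obtained by adding a unit to $S$, let $\mathbb{F}$ be any field, and let $\mathbb{F}\overline{S}$ be the monoid algebra of $\overline S$ over $\mathbb{F}$ (the algebra spanned by $\overline{S}$ over $\mathbb{F}$). Then $\mathbb{F}\overline{S}$ is a PI algebra.
   Context: An associative algebra $R$ over a field $\mathbb{F}$ is a PI (polynomial identity) algebra if there exist $n\ge 1$ and a nonzero element $p(X_1,\dots,X_n)$ of the free associative algebra $\mathbb{F}\langle X_1,\dots,X_n\rangle$ such that $p(r_1,\dots,r_n)=0$ for all $r_1,\dots,r_n\in R$. *)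

theory Defs
  imports Complex_Main "HOL-Library.Poly_Mapping" "HOL-Library.Disjoint_Sets"
begin

text \<open>Only positive exponents are meaningful; the value at \<open>0\<close> is junk.\<close>

definition spower :: "'s::semigroup_mult \<Rightarrow> nat \<Rightarrow> 's" where
  "spower a i = (((*) a) ^^ (i - 1)) a"

lemma spower_1 [simp]: "spower a 1 = a"
  by (simp add: spower_def)

lemma spower_Suc: "i > 0 \<Longrightarrow> spower a (Suc i) = a * spower a i"
  by (cases i) (simp_all add: spower_def)

definition monogenic :: "'s::semigroup_mult \<Rightarrow> 's set" where
  "monogenic a = {spower a i | i. i > 0}"

definition subsemigroup :: "'s::semigroup_mult set \<Rightarrow> bool" where
  "subsemigroup T \<longleftrightarrow> (\<forall>x\<in>T. \<forall>y\<in>T. x * y \<in> T)"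

definition iso_positive_integers :: "'s::semigroup_mult set \<Rightarrow> bool" where
  "iso_positive_integers T \<longleftrightarrow>
     (\<exists>\<phi> :: nat \<Rightarrow> 's. bij_betw \<phi> {0<..} T \<and> (\<forall>i>0. \<forall>j>0. \<phi> (i + j) = \<phi> i * \<phi> j))"

text \<open>
  A new unit is always added. The monoid operation is written additively because
  the convolution product on \<^typ>\<open>'m \<Rightarrow>\<^sub>0 'f\<close> is provided for \<^class>\<open>monoid_add\<close>;
  the operation itself is the (in general noncommutative) multiplication of the semigroup.
\<close>

datatype 's with_unit = Unit | Elem 's

instantiation with_unit :: (semigroup_mult) monoid_add
begin

definition zero_with_unit :: "'a with_unit" where
  "0 = Unit"

fun plus_with_unit :: "'a with_unit \<Rightarrow> 'a with_unit \<Rightarrow> 'a with_unit" where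
  "Unit + y = y"
| "Elem x + Unit = Elem x"
| "Elem x + Elem y = Elem (x * y)"

instance
proof
  fix x y z :: "'a with_unit"
  show "x + y + z = x + (y + z)"
    by (cases x; cases y; cases z) (simp_all add: mult.assoc)
  show "0 + x = x"
    by (simp add: zero_with_unit_def)
  show "x + 0 = x"
    by (cases x) (simp_all add: zero_with_unit_def)
qed

end

locale assoc_algebra = vector_space scale
  for scale :: "'f::field \<Rightarrow> 'r::ring_1 \<Rightarrow> 'r" +
  assumes scale_mult_left: "scale c x * y = scale c (x * y)"
    and scale_mult_right: "x * scale c y = scale c (x * y)"

type_synonym ('m, 'f) monoid_algebra = "'m \<Rightarrow>\<^sub>0 'f"

definition ma_scale :: "'f::field \<Rightarrow> ('m::monoid_add, 'f) monoid_algebra \<Rightarrow> ('m, 'f) monoid_algebra"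
  where "ma_scale c p = Poly_Mapping.map (\<lambda>x. c * x) p"

lemma lookup_ma_scale: "Poly_Mapping.lookup (ma_scale c p) m = c * Poly_Mapping.lookup p m"
  unfolding ma_scale_def by transfer (simp add: when_def)

lemma ma_scale_conv_mult: "ma_scale c p = Poly_Mapping.single 0 c * p"
  unfolding ma_scale_def by (rule mult_map_scale_conv_mult)

lemma ma_scale_conv_mult_right: "ma_scale c p = p * Poly_Mapping.single 0 c"
proof -
  have "Poly_Mapping.single 0 c * p = p * Poly_Mapping.single 0 c"
  proof (induction p rule: update_induct)
    case (update p a b)
    have "Poly_Mapping.update a b p = p + Poly_Mapping.single a b"
      using update.hyps
      by (auto simp: poly_mapping_eq_iff fun_eq_iff lookup_update lookup_add lookup_single
          in_keys_iff when_def)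
    with update.IH show ?case
      by (simp add: mult_single mult.commute distrib_left distrib_right)
  qed simp
  thus ?thesis
    by (simp add: ma_scale_conv_mult)
qed

lemma assoc_algebra_ma_scale:
  "assoc_algebra (ma_scale :: 'f::field \<Rightarrow> ('m::monoid_add, 'f) monoid_algebra \<Rightarrow> _)"
proof
  fix c d :: 'f and x y :: "('m, 'f) monoid_algebra"
  show "ma_scale c (x + y) = ma_scale c x + ma_scale c y"
    "ma_scale (c + d) x = ma_scale c x + ma_scale d x"
    "ma_scale c (ma_scale d x) = ma_scale (c * d) x"
    "ma_scale 1 x = x"
    by (simp_all add: poly_mapping_eq_iff fun_eq_iff lookup_ma_scale lookup_add algebra_simps)
  show "ma_scale c x * y = ma_scale c (x * y)"
    by (simp add: ma_scale_conv_mult mult.assoc)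
  show "x * ma_scale c y = ma_scale c (x * y)"
    by (simp add: ma_scale_conv_mult_right mult.assoc)
qed

datatype 'x free_monoid = Word (letters: "'x list")

instantiation free_monoid :: (type) monoid_add
begin

definition zero_free_monoid :: "'a free_monoid" where
  "0 = Word []"

definition plus_free_monoid :: "'a free_monoid \<Rightarrow> 'a free_monoid \<Rightarrow> 'a free_monoid" where
  "u + v = Word (letters u @ letters v)"

instance
  by standard (simp_all add: zero_free_monoid_def plus_free_monoid_def)

end

text \<open>
  The algebra on countably many indeterminates; \<open>free_algebra n\<close> is its subalgebra
  on \<open>X\<^sub>1, \<dots>, X\<^sub>n\<close>.
\<close>

type_synonym 'f nc_poly = "(nat free_monoid, 'f) monoid_algebra"

definition free_algebra :: "nat \<Rightarrow> 'f::field nc_poly set" where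
  "free_algebra n = {p. \<forall>w \<in> Poly_Mapping.keys p. set (letters w) \<subseteq> {1..n}}"

text \<open>
  Substitution of \<open>r i\<close> for \<open>X\<^sub>i\<close>. The empty word is sent to \<open>1\<close>, so constant
  terms are allowed; this is why algebras are taken to be unital.
\<close>

definition nc_eval ::
  "('f::field \<Rightarrow> 'r::ring_1 \<Rightarrow> 'r) \<Rightarrow> (nat \<Rightarrow> 'r) \<Rightarrow> 'f nc_poly \<Rightarrow> 'r" where
  "nc_eval scale r p = (\<Sum>w\<in>Poly_Mapping.keys p. scale (Poly_Mapping.lookup p w) (prod_list (map r (letters w))))"

definition PI_algebra :: "('f::field \<Rightarrow> 'r::ring_1 \<Rightarrow> 'r) \<Rightarrow> bool" where
  "PI_algebra scale \<longleftrightarrow> assoc_algebra scale \<and>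
     (\<exists>n\<ge>1. \<exists>p \<in> free_algebra n. p \<noteq> 0 \<and> (\<forall>r. nc_eval scale r p = 0))"

end

theory Submission
  imports Defs "HOL-Combinatorics.Permutations"
begin

text \<open>
  For an ideal \<open>I\<close> of \<open>S\<close>, we look for a polynomial all of whose values lie in the span of
  \<open>I\<close>. A left ideal that meets \<open>N\<^sub>a\<close> contains almost all of \<open>N\<^sub>a\<close>. If \<open>I\<close> meets every
  \<open>N\<^sub>a\<close>, then \<open>S - I\<close> is finite and a standard polynomial works. Otherwise choose a left ideal
  \<open>L = I \<union> S\<^sup>1t\<close>, with no power of \<open>t\<close> in \<open>I\<close>, that meets as few of the \<open>N\<^sub>a\<close> as possible.
  Modulo \<open>I\<close>, it is finitely generated under right multiplication by \<open>t\<close>. Left multiplications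
  are therefore endomorphisms of a finitely generated module over \<open>F[t]\<close>, so a standard
  polynomial maps the span of \<open>L\<close>, and hence that of the larger ideal \<open>I' = I \<union> S\<^sup>1tS\<^sup>1\<close>, into the
  span of \<open>I\<close>. Multiplying it by a polynomial for \<open>I'\<close> gives one for \<open>I\<close>, and finitely many
  such steps reach \<open>I = {}\<close>.
\<close>

subsection \<open>Ideals in unions of monogenic semigroups\<close>

lemma spower_Suc_0 [simp]: "spower a (Suc 0) = a"
  by (simp add: spower_def)

lemma spower_add: "0 < i \<Longrightarrow> 0 < j \<Longrightarrow> spower a (i + j) = spower a i * spower a j"
proof (induction i rule: nat_induct_non_zero)
  case 1
  then show ?case by (simp add: spower_Suc)
next
  case (Suc n)
  then show ?case by (simp add: spower_Suc mult.assoc)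
qed

lemma spower_mult:
  assumes "0 < i" "0 < j"
  shows "spower a (i * j) = spower (spower a i) j"
  using assms(2)
proof (induction j rule: nat_induct_non_zero)
  case (Suc n)
  then show ?case using assms(1) by (simp add: spower_Suc spower_add)
qed simp

lemma monogenic_iff: "s \<in> monogenic a \<longleftrightarrow> (\<exists>i>0. s = spower a i)"
  by (auto simp: monogenic_def)

text \<open>A repetition lets \<open>j - i\<close> be subtracted from any exponent that is at least
  \<open>j\<close>, so every power already occurs with an exponent below \<open>j\<close>.\<close>

lemma finite_monogenic:
  assumes "0 < i" "i < j" "spower a i = spower a j"
  shows "finite (monogenic a)"
proof -
  have "spower a n \<in> spower a ` {0<..<j}" if "0 < n" for n
    using that
  proof (induction n rule: less_induct)
    case (less n)
    show ?case
    proof (cases "n < j")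
      case True
      with less.prems show ?thesis by auto
    next
      case False
      have "spower a n = spower a (i + (n - j))"
      proof (cases "n = j")
        case True
        then show ?thesis using assms by simp
      next
        case False
        with \<open>\<not> n < j\<close> have "spower a (j + (n - j)) = spower a (i + (n - j))"
          using assms by (simp only: spower_add)
        then show ?thesis using \<open>\<not> n < j\<close> by simp
      qed
      then show ?thesis using less.IH[of "i + (n - j)"] False assms by auto
    qed
  qed
  then have "monogenic a \<subseteq> spower a ` {0<..<j}"
    by (auto simp: monogenic_def)
  then show ?thesis
    by (rule finite_subset) simp
qed

text \<open>The bijection with the positive integers makes \<open>monogenic a\<close> infinite,
  whereas a repeated power would make it finite.\<close>

lemma spower_inject:
  assumes "iso_positive_integers (monogenic a)" "0 < i" "0 < j" "spower a i = spower a j"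
  shows "i = j"
proof (rule ccontr)
  assume "i \<noteq> j"
  then have "finite (monogenic a)"
    using finite_monogenic[of i j a] finite_monogenic[of j i a] assms by (metis nat_neq_iff)
  moreover obtain \<phi> :: "nat \<Rightarrow> 'a" where "bij_betw \<phi> {0<..} (monogenic a)"
    using assms(1) unfolding iso_positive_integers_def by blast
  ultimately show False
    using bij_betw_finite infinite_Ioi by blast
qed

section \<open>One-sided ideals, radicals and principal left ideals\<close>

definition left_ideal :: "'s::semigroup_mult set \<Rightarrow> bool" where
  "left_ideal I \<longleftrightarrow> (\<forall>s. \<forall>x\<in>I. s * x \<in> I)"

definition right_ideal :: "'s::semigroup_mult set \<Rightarrow> bool" where
  "right_ideal I \<longleftrightarrow> (\<forall>s. \<forall>x\<in>I. x * s \<in> I)"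

text \<open>Measures an ideal by finite data: for a left ideal this set is a union of full pieces
  (\<open>radical_eq\<close>) and exceeds the ideal by only finitely many elements
  (\<open>finite_radical_diff\<close>).\<close>

definition radical :: "'s::semigroup_mult set \<Rightarrow> 's set" where
  "radical I = {s. \<exists>n>0. spower s n \<in> I}"

text \<open>The principal left ideal S^1 t; \<open>t\<close> is inserted because the semigroup may
  lack a unit.\<close>

definition left_multiples :: "'s::semigroup_mult \<Rightarrow> 's set" where
  "left_multiples t = insert t (range (\<lambda>s. s * t))"

lemma self_in_left_multiples: "t \<in> left_multiples t"
  by (simp add: left_multiples_def)

lemma left_multiples_mult: "u \<in> left_multiples t \<Longrightarrow> s * u \<in> left_multiples t"
  by (auto simp: left_multiples_def simp flip: mult.assoc)

lemma left_ideal_Un_left_multiples: "left_ideal I \<Longrightarrow> left_ideal (I \<union> left_multiples t)"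
  by (auto simp: left_ideal_def left_multiples_mult)

lemma left_multiples_subset:
  "left_ideal I \<Longrightarrow> u \<in> I \<Longrightarrow> left_multiples u \<subseteq> I"
  unfolding left_ideal_def left_multiples_def by auto

lemma radical_mono: "I \<subseteq> J \<Longrightarrow> radical I \<subseteq> radical J"
  by (auto simp: radical_def)

lemma subset_radical: "I \<subseteq> radical I"
  unfolding radical_def by (auto intro!: exI[of _ 1])

lemma spower_left_multiple:
  assumes "s * x = x" "0 < n"
  shows "spower s n * x = x"
  using assms(2) by (induction n rule: nat_induct_non_zero) (simp_all add: spower_Suc mult.assoc assms(1))

locale monogenic_union =
  fixes A :: "'s::semigroup_mult set"
  assumes finite_generators: "finite A"
    and cover: "(\<Union>a\<in>A. monogenic a) = UNIV"
    and generator_inject: "\<And>a i j. a \<in> A \<Longrightarrow> 0 < i \<Longrightarrow> 0 < j \<Longrightarrow> spower a i = spower a j \<Longrightarrow> i = j"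
begin

lemma generatorE:
  fixes s :: 's
  obtains a k where "a \<in> A" "0 < k" "s = spower a k"
  using cover by (metis UNIV_I UN_E monogenic_iff)

text \<open>Powers of \<open>spower a k\<close> are powers of the generator \<open>a\<close>, with
  exponents multiplied by \<open>k\<close>.\<close>

lemma aperiodic:
  fixes s :: 's
  assumes "0 < i" "0 < j" "spower s i = spower s j"
  shows "i = j"
proof -
  obtain a k where a: "a \<in> A" "0 < k" "s = spower a k"
    by (rule generatorE)
  then have "k * i = k * j"
    using assms generator_inject[OF a(1), of "k * i" "k * j"] by (simp add: spower_mult)
  then show ?thesis using a by simp
qed

text \<open>If \<open>spower a n\<close> lies in the left ideal, so does its left multiple
  \<open>spower a (k * n)\<close>, which is a power of \<open>spower a k\<close>. Conversely, a
  power of \<open>s\<close> is a power of \<open>a\<close>.\<close>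

lemma radical_iff:
  fixes I :: "'s set"
  assumes "left_ideal I" "s \<in> monogenic a"
  shows "s \<in> radical I \<longleftrightarrow> a \<in> radical I"
proof -
  obtain k where k: "0 < k" "s = spower a k"
    using assms(2) by (auto simp: monogenic_iff)
  show ?thesis
  proof
    assume "s \<in> radical I"
    then obtain n where "n > 0" "spower a (k * n) \<in> I"
      using k by (auto simp: radical_def spower_mult)
    then show "a \<in> radical I"
      using k unfolding radical_def by (auto intro!: exI[of _ "k * n"])
  next
    assume "a \<in> radical I"
    then obtain n where n: "n > 0" "spower a n \<in> I"
      by (auto simp: radical_def)
    have "spower a (k * n) \<in> I"
    \<comment> \<open>For \<open>k = 1\<close> the left factor below would have exponent 0, where
      \<open>spower\<close> is junk.\<close>
    proof (cases "k = 1")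
      case False
      then have "spower a ((k - 1) * n + n) = spower a ((k - 1) * n) * spower a n"
        using k n by (intro spower_add) auto
      moreover have "(k - 1) * n + n = k * n"
        using k by (cases k) auto
      ultimately show ?thesis
        using assms(1) n by (simp add: left_ideal_def)
    qed (use n in simp)
    then show "s \<in> radical I"
      using n spower_mult[OF k(1) n(1), of a] k(2) unfolding radical_def by auto
  qed
qed

text \<open>Recovers a radical from its finite trace on \<open>A\<close>, so that comparing radicals
  amounts to comparing subsets of \<open>A\<close>.\<close>

lemma radical_eq:
  fixes I :: "'s set"
  assumes "left_ideal I"
  shows "radical I = (\<Union>a \<in> A \<inter> radical I. monogenic a)"
proof (rule set_eqI)
  fix s :: 's
  obtain a where "a \<in> A" "s \<in> monogenic a"
    using cover by blast
  then show "s \<in> radical I \<longleftrightarrow> s \<in> (\<Union>a \<in> A \<inter> radical I. monogenic a)"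
    using radical_iff[OF assms] by blast
qed

text \<open>Once \<open>spower a n\<close> is in the left ideal, so are all higher powers; each of
  the finitely many pieces in the radical thus misses only finitely many elements.\<close>

lemma finite_radical_diff:
  fixes I :: "'s set"
  assumes "left_ideal I"
  shows "finite (radical I - I)"
proof -
  have "finite (monogenic a - I)" if a: "a \<in> radical I" for a
  proof -
    obtain n where n: "n > 0" "spower a n \<in> I"
      using a by (auto simp: radical_def)
    have "spower a i \<in> I" if "i \<ge> n" for i
    proof (cases "i = n")
      case False
      have "spower a ((i - n) + n) = spower a (i - n) * spower a n"
        using n that False by (intro spower_add) auto
      then show ?thesis
        using assms n that by (simp add: left_ideal_def)
    qed (use n in simp)
    then have "monogenic a - I \<subseteq> spower a ` {..<n}"
      by (force simp: monogenic_iff not_le)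
    then show ?thesis
      by (rule finite_subset) simp
  qed
  then have "finite (\<Union>a \<in> A \<inter> radical I. monogenic a - I)"
    using finite_generators by blast
  moreover have "radical I - I \<subseteq> (\<Union>a \<in> A \<inter> radical I. monogenic a - I)"
    by (subst radical_eq[OF assms]) blast
  ultimately show ?thesis
    by (rule rev_finite_subset)
qed

section \<open>Pigeonhole arguments and finite generation modulo an ideal\<close>

lemma pigeonhole_generator:
  fixes f :: "nat \<Rightarrow> 's"
  obtains a i j m n where "a \<in> A" "0 < i" "i < j" "0 < m" "0 < n" "f i = spower a m" "f j = spower a n"
proof -
  have "\<forall>i. \<exists>a. a \<in> A \<and> f i \<in> monogenic a"
    using cover by blast
  then obtain c where c: "\<And>i. c i \<in> A" "\<And>i. f i \<in> monogenic (c i)"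
    by metis
  have "finite (c ` {0<..})"
    using c(1) finite_generators by (meson finite_subset image_subsetI)
  then have "\<not> inj_on c {0<..}"
    using finite_imageD infinite_Ioi by blast
  then obtain i j where "0 < i" "i < j" "c i = c j"
    unfolding inj_on_def by (metis greaterThan_iff linorder_neqE_nat)
  then show thesis
    using that c by (metis monogenic_iff)
qed

text \<open>
  The elements \<open>T\<^sup>i e\<^sup>j\<close> would form a two-dimensional grid, which does not fit
  into finitely many monogenic pieces.
\<close>

lemma no_grid:
  fixes e T :: 's
  assumes eT: "e * T = T"
    and absorb: "\<And>i. 0 < i \<Longrightarrow> \<exists>p>0. spower e p \<in> left_multiples (spower T i)"
  shows False
proof -
  have e_pow: "spower e j * T = T" if "0 < j" for j
    using that eT by (rule spower_left_multiple[rotated])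
  \<comment> \<open>Some \<open>spower e p\<close> is a left multiple of \<open>spower T i\<close>,
    so multiplying on the left turns the equation into one between powers of
    \<open>e\<close>.\<close>
  have grid_inj: "j = j'"
    if ij: "0 < i" "0 < j" "0 < j'" "spower T i * spower e j = spower T i * spower e j'" for i j j'
  proof -
    obtain p where p: "p > 0" "spower e p \<in> left_multiples (spower T i)"
      using absorb ij(1) by blast
    then consider "spower e p = spower T i" | s where "spower e p = s * spower T i"
      by (auto simp: left_multiples_def)
    then have "spower e p * spower e j = spower e p * spower e j'"
      by cases (use that in \<open>simp_all add: mult.assoc\<close>)
    then have "spower e (p + j) = spower e (p + j')"
      using p that by (simp add: spower_add)
    then have "p + j = p + j'"
      using p that by (intro aperiodic[of _ _ e]) auto
    then show ?thesis by simp
  qed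
  \<comment> \<open>Row \<open>i\<close> of the grid meets one piece twice, in distinct powers of
    some \<open>c\<close>. Since \<open>spower e j * T = T\<close>, both send \<open>T\<close> to
    \<open>spower T (Suc i)\<close>, so \<open>c\<close> raised to the difference of the two
    exponents fixes that element.\<close>
  have ex: "\<exists>c n q. c \<in> A \<and> 0 < n \<and> 0 < q \<and> spower c n * T = spower T (Suc i) \<and>
      spower c q * spower T (Suc i) = spower T (Suc i)" if "0 < i" for i
  proof -
    obtain c j j' m n where c: "c \<in> A" "0 < j" "j < j'" "0 < m" "0 < n"
      "spower T i * spower e j = spower c m" "spower T i * spower e j' = spower c n"
      by (rule pigeonhole_generator[of "\<lambda>j. spower T i * spower e j"])
    have TT: "spower T i * T = spower T (Suc i)"
      using spower_add[of i 1 T] that by simp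
    have m: "spower c m * T = spower T (Suc i)" and n: "spower c n * T = spower T (Suc i)"
      using c that TT e_pow by (simp_all add: mult.assoc flip: c(6,7))
    have "m \<noteq> n"
      using c grid_inj[OF that, of j j'] by auto
    moreover have "spower c (n' - m') * spower T (Suc i) = spower T (Suc i)"
      if "m' < n'" "0 < m'" "spower c m' * T = spower T (Suc i)" "spower c n' * T = spower T (Suc i)" for m' n'
    proof -
      have "spower c ((n' - m') + m') = spower c (n' - m') * spower c m'"
        using that by (intro spower_add) auto
      with that show ?thesis
        by (simp add: mult.assoc)
    qed
    ultimately have "\<exists>q>0. spower c q * spower T (Suc i) = spower T (Suc i)"
      using m n c by (metis nat_neq_iff zero_less_diff)
    then show ?thesis
      using c m by blast
  qed
  then obtain c n q where c: "\<And>i. 0 < i \<Longrightarrow> c i \<in> A" "\<And>i. 0 < i \<Longrightarrow> 0 < n i" "\<And>i. 0 < i \<Longrightarrow> 0 < q i"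
    "\<And>i. 0 < i \<Longrightarrow> spower (c i) (n i) * T = spower T (Suc i)"
    "\<And>i. 0 < i \<Longrightarrow> spower (c i) (q i) * spower T (Suc i) = spower T (Suc i)"
    by metis
  have "finite (c ` {0<..})"
    using c(1) finite_generators by (meson finite_subset greaterThan_iff image_subsetI)
  then have "\<not> inj_on c {0<..}"
    using finite_imageD infinite_Ioi by blast
  \<comment> \<open>There are infinitely many rows and finitely many generators, so two rows use the
    same one.\<close>
  then obtain i i' where i: "0 < i" "i < i'" "c i = c i'"
    unfolding inj_on_def by (metis greaterThan_iff linorder_neqE_nat)
  then have i': "0 < i'" by simp
  define b where "b = c i"
  define r where "r = q i"
  define D where "D = i' - i"
  have r: "0 < r" and D: "0 < D" using c i by (auto simp: r_def D_def)
  have n: "0 < n i" "0 < n i'" using c i i' by auto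
  have shift: "spower T (Suc i + k) = spower T (Suc i) * spower T k" if "0 < k" for k
    using that by (intro spower_add) auto
  have fix1: "spower b r * spower T (Suc i) = spower T (Suc i)"
    using c(5)[OF i(1)] by (simp only: b_def r_def)
  have fix_mult: "spower b (r * l) * spower T (Suc i) = spower T (Suc i)" if "0 < l" for l
    using spower_left_multiple[OF fix1 that] r that by (simp add: spower_mult)
  have Ti': "spower T (Suc i') = spower T (Suc i) * spower T D"
    using shift[OF D] i by (simp add: D_def)
  \<comment> \<open>The summand \<open>r * n i\<close> acts trivially on
    \<open>spower T (Suc i)\<close>, so the product with \<open>T\<close> is still
    \<open>spower T (Suc i')\<close>, while \<open>M\<close> exceeds \<open>n i\<close> and the
    difference \<open>d\<close> is positive.\<close>
  define M where "M = r * n i + n i'"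
  have "spower b M = spower b (r * n i) * spower b (n i')"
    unfolding M_def using r n by (intro spower_add) auto
  then have "spower b M * T = spower b (r * n i) * (spower b (n i') * T)"
    by (simp only: mult.assoc)
  also have "\<dots> = spower b (r * n i) * (spower T (Suc i) * spower T D)"
    using c(4)[OF i'] by (simp only: b_def i(3) Ti')
  also have "\<dots> = spower T (Suc i')"
    by (simp only: Ti' fix_mult[OF n(1)] flip: mult.assoc)
  finally have M: "spower b M * T = spower T (Suc i')" .
  define d where "d = M - n i"
  have "n i \<le> r * n i" using r by simp
  then have d: "0 < d" "M = d + n i" using n unfolding d_def M_def by linarith+
  then have "spower b M = spower b d * spower b (n i)"
    using n spower_add by metis
  then have step: "spower b d * spower T (Suc i) = spower T (Suc i) * spower T D"
    using M c(4)[OF i(1)] by (simp only: b_def Ti' mult.assoc)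
  have powers: "spower (spower b d) l * spower T (Suc i) = spower T (Suc i) * spower T (D * l)" if "0 < l" for l
    using that
  proof (induction l rule: nat_induct_non_zero)
    case 1
    then show ?case using step by simp
  next
    case (Suc l)
    have "spower T (D * Suc l) = spower T D * spower T (D * l)"
      using spower_add[of D "D * l" T] D Suc by simp
    then show ?case
      using Suc step by (simp only: spower_Suc mult.assoc) (simp only: flip: mult.assoc)
  qed
  \<comment> \<open>As a power of \<open>spower b d\<close> this element shifts the exponent of
    \<open>T\<close> by \<open>D * r\<close>; as a power of \<open>spower b r\<close> it shifts
    nothing. Aperiodicity of \<open>T\<close> excludes both at once.\<close>
  have "spower b (d * r) * spower T (Suc i) = spower T (Suc i) * spower T (D * r)"
    using powers[OF r] by (simp only: spower_mult[OF d(1) r])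
  also have "\<dots> = spower T (Suc i + D * r)"
    by (rule shift[symmetric]) (use r D in simp)
  finally have "spower b (d * r) * spower T (Suc i) = spower T (Suc i + D * r)" .
  moreover have "spower b (d * r) * spower T (Suc i) = spower T (Suc i)"
    using fix_mult[OF d(1)] by (simp add: mult.commute)
  ultimately have "Suc i = Suc i + D * r"
    by (intro aperiodic[of _ _ T]) auto
  then show False using D r by simp
qed

text \<open>\<open>t\<close> minimises the number of generators in the radical of its left ideal. An
  admissible \<open>u\<close> inside gives a smaller left ideal, which by minimality has the same
  generators in its radical.\<close>

lemma minimal_left_ideal:
  fixes I :: "'s set"
  assumes I: "left_ideal I" and "radical I \<noteq> UNIV"
  obtains t where "t \<notin> radical I"
    and "\<And>u. u \<in> I \<union> left_multiples t \<Longrightarrow> u \<notin> radical I \<Longrightarrow>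
           radical (I \<union> left_multiples u) = radical (I \<union> left_multiples t)"
proof -
  let ?L = "\<lambda>t. I \<union> left_multiples t"
  let ?m = "\<lambda>t. card (A \<inter> radical (?L t))"
  obtain t where t: "t \<notin> radical I" "\<And>u. u \<notin> radical I \<Longrightarrow> ?m t \<le> ?m u"
    using assms(2) ex_has_least_nat[of "\<lambda>t. t \<notin> radical I" _ ?m] by blast
  show thesis
  proof (rule that[OF t(1)])
    fix u assume u: "u \<in> ?L t" "u \<notin> radical I"
    have "?L u \<subseteq> ?L t"
      using left_multiples_subset[OF left_ideal_Un_left_multiples[OF I] u(1)] by blast
    then have "A \<inter> radical (?L u) \<subseteq> A \<inter> radical (?L t)"
      using radical_mono by blast
    then have "A \<inter> radical (?L u) = A \<inter> radical (?L t)"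
      using t(2)[OF u(2)] finite_generators by (intro card_seteq) auto
    then show "radical (?L u) = radical (?L t)"
      using radical_eq[OF left_ideal_Un_left_multiples[OF I]] by metis
  qed
qed

text \<open>By minimality the left ideals of \<open>t\<close> and \<open>t * t\<close> have the same
  radical, hence differ finitely modulo \<open>I\<close>. Elements outside this finite difference
  can be divided by \<open>t\<close> on the right, and endless division would produce the grid
  excluded by \<open>no_grid\<close>.\<close>

lemma finitely_generated_right_act:
  fixes I :: "'s set"
  assumes lI: "left_ideal I" and rI: "right_ideal I" and "radical I \<noteq> UNIV"
  obtains t G where "t \<notin> radical I" "finite G" "G \<subseteq> I \<union> left_multiples t"
    and "\<And>u. u \<in> left_multiples t \<Longrightarrow> u \<in> I \<or> (\<exists>g\<in>G. \<exists>n. u = ((\<lambda>x. x * t) ^^ n) g)"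
proof -
  let ?L = "\<lambda>t. I \<union> left_multiples t"
  obtain t where t: "t \<notin> radical I"
    and min: "\<And>u. u \<in> ?L t \<Longrightarrow> u \<notin> radical I \<Longrightarrow> radical (?L u) = radical (?L t)"
    using minimal_left_ideal[OF lI assms(3)] by blast
  define \<tau> where "\<tau> = (\<lambda>x. x * t)"
  have leftL: "left_ideal (?L u)" for u
    by (rule left_ideal_Un_left_multiples[OF lI])
  \<comment> \<open>All powers of \<open>e\<close> fix \<open>x\<close>, so a power in the right
    ideal \<open>I\<close> would pull \<open>x\<close> into \<open>I\<close>.\<close>
  have not_rad: "e \<notin> radical I" if "e * x = x" "x \<notin> I" for e x
  proof
    assume "e \<in> radical I"
    then obtain n where n: "0 < n" "spower e n \<in> I"
      by (auto simp: radical_def)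
    then have "spower e n * x \<in> I"
      using rI by (simp add: right_ideal_def)
    then show False
      using spower_left_multiple[OF that(1) n(1)] that(2) by simp
  qed
  have t_pow: "spower t n \<notin> I" if "0 < n" for n
    using t that unfolding radical_def by blast
  have t_pow_L: "spower t n \<in> ?L t" if "0 < n" for n
    using that by (induction n rule: nat_induct_non_zero)
      (use leftL[of t] in \<open>auto simp: spower_Suc left_ideal_def left_multiples_def\<close>)
  have t_pow_rad: "spower t n \<notin> radical I" if "0 < n" for n
  proof
    assume "spower t n \<in> radical I"
    then obtain k where "0 < k" "spower (spower t n) k \<in> I"
      unfolding radical_def by blast
    then show False
      using t_pow[of "n * k"] that by (simp add: spower_mult)
  qed
  have funpow_t: "(\<tau> ^^ n) x = x * spower t n" if "0 < n" for n x
    using that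
  proof (induction n rule: nat_induct_non_zero)
    case (Suc n)
    have "spower t (Suc n) = spower t n * t"
      using spower_add[of n 1 t] Suc by simp
    with Suc show ?case by (simp add: \<tau>_def mult.assoc)
  qed (simp add: \<tau>_def)
  \<comment> \<open>This is the form in which minimality is used: the two radicals coincide, and
    \<open>v\<close> lies in the larger one.\<close>
  have absorb: "\<exists>p>0. spower v p \<in> ?L u" if "u \<in> ?L t" "u \<notin> radical I" "v \<in> ?L t" for u v
    using min[OF that(1,2)] that(3) subset_radical[of "?L t"] by (auto simp: radical_def)
  have tt: "t * t \<in> ?L t" "t * t \<notin> radical I"
    using t_pow_L[of 2] t_pow_rad[of 2] by (simp_all add: numeral_2_eq_2 spower_Suc)
  \<comment> \<open>The second set holds what \<open>step\<close> cannot divide by \<open>t\<close>;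
    the third removes elements of the radical outside \<open>I\<close>, so that
    \<open>absorb\<close> applies to whatever is left.\<close>
  define G where "G = insert t ((?L t - ?L (t * t)) \<union> (?L t \<inter> (radical I - I)))"
  have "?L t - ?L (t * t) \<subseteq> radical (?L (t * t)) - ?L (t * t)"
    using min[OF tt] subset_radical[of "?L t"] by blast
  then have "finite (?L t - ?L (t * t))"
    using finite_radical_diff[OF leftL] finite_subset by blast
  then have "finite G"
    using finite_radical_diff[OF lI] by (simp add: G_def)
  have "G \<subseteq> ?L t"
    by (auto simp: G_def left_multiples_def)
  have step: "\<exists>u'. u' \<in> ?L t \<and> u' \<notin> I \<and> u = u' * t" if "u \<in> ?L t" "u \<notin> I" "u \<notin> G" for u
  proof -
    have "u \<in> left_multiples (t * t)"
      using that by (auto simp: G_def)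
    then obtain u' where "u = u' * t" "u' \<in> left_multiples t"
      by (auto simp: left_multiples_def simp flip: mult.assoc)
    then show ?thesis
      using that(2) rI by (auto simp: right_ideal_def)
  qed
  have "u \<in> I \<or> (\<exists>g\<in>G. \<exists>n. u = (\<tau> ^^ n) g)" if u: "u \<in> ?L t" for u
  proof (rule ccontr)
    assume "\<not> ?thesis"
    then have uI: "u \<notin> I" and no: "\<And>g n. g \<in> G \<Longrightarrow> u \<noteq> (\<tau> ^^ n) g"
      by blast+
    \<comment> \<open>Division by \<open>t\<close> never stops, since reaching \<open>G\<close>
      would express \<open>u\<close> as a forbidden iterate.\<close>
    have descend: "\<exists>x. x \<in> ?L t \<and> x \<notin> I \<and> u = (\<tau> ^^ n) x" for n
    proof (induction n)
      case (Suc n)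
      then obtain x where x: "x \<in> ?L t" "x \<notin> I" "u = (\<tau> ^^ n) x"
        by blast
      with no obtain y where "y \<in> ?L t" "y \<notin> I" "x = y * t"
        using step by blast
      with x show ?case
        by (intro exI[of _ y]) (simp add: funpow_swap1, simp add: \<tau>_def)
    qed (use u uI in auto)
    have "u \<notin> G"
      using no[of u 0] by auto
    with u uI have "u \<notin> radical I"
      by (auto simp: G_def)
    then obtain k where k: "k > 0" "spower t k \<in> ?L u"
      using absorb[OF u _ , of t] by (auto simp: self_in_left_multiples)
    \<comment> \<open>One more factor than \<open>k\<close> is taken out: the spare \<open>t\<close>
      puts \<open>e\<close> below into \<open>left_multiples t\<close>, as \<open>absorb\<close>
      requires.\<close>
    obtain x where x: "u = (\<tau> ^^ Suc k) x"
      using descend by blast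
    have "u = x * (t * spower t k)"
      using x funpow_t[of "Suc k"] k by (simp add: spower_Suc)
    moreover have "spower t k \<in> left_multiples u"
      using k t_pow by auto
    ultimately obtain e where e: "spower t k = e * spower t k" "e \<in> left_multiples t"
      by (auto simp: left_multiples_def mult.assoc) (metis mult.assoc rangeI)+
    have "e \<notin> radical I"
      using not_rad[of e] e(1) t_pow[OF k(1)] by metis
    \<comment> \<open>This is the absorption hypothesis of \<open>no_grid\<close> for
      \<open>T = spower t k\<close>; the alternative that a power of \<open>e\<close> lies in
      \<open>I\<close> is excluded.\<close>
    have "\<exists>p>0. spower e p \<in> left_multiples (spower (spower t k) i)" if "0 < i" for i
    proof -
      have "0 < k * i" using k that by simp
      from absorb[OF t_pow_L[OF this] t_pow_rad[OF this], of e] e(2)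
      obtain p where "p > 0" "spower e p \<in> ?L (spower t (k * i))"
        by auto
      then show ?thesis
        using \<open>e \<notin> radical I\<close> unfolding radical_def spower_mult[OF k(1) that] by blast
    qed
    with no_grid[of e "spower t k"] e(1) show False
      by simp
  qed
  then show thesis
    using that t \<open>finite G\<close> \<open>G \<subseteq> ?L t\<close> unfolding \<tau>_def by blast
qed

end

subsection \<open>Standard polynomials\<close>

text \<open>The transposition matches even with odd permutations, so the two halves cancel. Pairing
  the terms, rather than deducing that twice the sum is 0, keeps characteristic 2 included.\<close>

lemma sum_sign_reversing_eq_0:
  fixes f :: "(nat \<Rightarrow> nat) \<Rightarrow> 'b::ab_group_add"
  assumes F: "finite F" "\<And>\<sigma>. \<sigma> \<in> F \<Longrightarrow> permutation \<sigma>"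
    and swap: "p \<noteq> q" "\<And>\<sigma>. \<sigma> \<in> F \<Longrightarrow> \<sigma> \<circ> transpose p q \<in> F"
    and f: "\<And>\<sigma>. \<sigma> \<in> F \<Longrightarrow> f (\<sigma> \<circ> transpose p q) = - f \<sigma>"
  shows "sum f F = 0"
proof -
  let ?T = "\<lambda>\<sigma>. \<sigma> \<circ> transpose p q"
  let ?E = "{\<sigma> \<in> F. evenperm \<sigma>}" and ?O = "{\<sigma> \<in> F. \<not> evenperm \<sigma>}"
  have T: "evenperm (?T \<sigma>) \<longleftrightarrow> \<not> evenperm \<sigma>" if "\<sigma> \<in> F" for \<sigma>
    using evenperm_comp[OF F(2)[OF that] permutation_swap_id] swap(1) by (simp add: evenperm_swap)
  have TT: "?T (?T \<sigma>) = \<sigma>" for \<sigma> :: "nat \<Rightarrow> nat"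
    by (simp add: comp_assoc)
  have "sum f ?O = (\<Sum>\<sigma>\<in>?E. f (?T \<sigma>))"
    by (rule sum.reindex_bij_witness[of _ ?T ?T]) (use T TT swap(2) in auto)
  also have "\<dots> = - sum f ?E"
    using f by (simp add: sum_negf)
  finally have "sum f ?E + sum f ?O = 0"
    by simp
  moreover have "sum f F = sum f ?E + sum f ?O"
    using F(1) by (subst sum.union_disjoint[symmetric]) (auto intro: sum.cong)
  ultimately show ?thesis by simp
qed

text \<open>The reversal makes words grow on the left, the side from which letters act on
  generators.\<close>

definition word_prod :: "(nat \<Rightarrow> 'm::monoid_add) \<Rightarrow> (nat \<Rightarrow> nat) \<Rightarrow> nat \<Rightarrow> 'm" where
  "word_prod s \<sigma> k = sum_list (map (\<lambda>j. s (\<sigma> j)) (rev [0..<k]))"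

lemma word_prod_0 [simp]: "word_prod s \<sigma> 0 = 0"
  and word_prod_Suc [simp]: "word_prod s \<sigma> (Suc k) = s (\<sigma> k) + word_prod s \<sigma> k"
  by (simp_all add: word_prod_def)

text \<open>Models a module over F[\<tau>] generated by \<open>G\<close> modulo the span of
  \<open>I\<close>; left multiplications are endomorphisms because they commute with
  \<open>\<tau>\<close>.\<close>

locale act_generators =
  fixes I G :: "'m::monoid_add set" and \<tau> :: "'m \<Rightarrow> 'm"
  assumes left: "x \<in> I \<Longrightarrow> s + x \<in> I"
    and \<tau>_closed: "x \<in> I \<Longrightarrow> \<tau> x \<in> I"
    and \<tau>_left: "s + \<tau> x = \<tau> (s + x)"
    and finite_G: "finite G"
    and generates: "g \<in> G \<Longrightarrow> s + g \<in> I \<or> (\<exists>h\<in>G. \<exists>n. s + g = (\<tau> ^^ n) h)"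
begin

lemma funpow_closed: "x \<in> I \<Longrightarrow> (\<tau> ^^ n) x \<in> I"
  by (induction n) (simp_all add: \<tau>_closed)

lemma funpow_left: "s + (\<tau> ^^ n) x = (\<tau> ^^ n) (s + x)"
  by (induction n) (simp_all add: \<tau>_left)

text \<open>
  Modulo \<open>I\<close>, the word \<open>s (\<sigma> (N - 1)) + \<dots> + s (\<sigma> 0) + g\<close> traces a path in \<open>G\<close> and its value is
  determined by the end point and the total power of \<open>\<tau>\<close>. A path of more than \<open>|G|\<^sup>2\<close> steps
  uses some edge twice, and swapping the two letters at these places changes only the sign of \<open>\<sigma>\<close>.
\<close>

lemma alternating_sum_words:
  assumes g: "g \<in> G" and N: "card G * card G < N"
  shows "Poly_Mapping.keys (\<Sum>\<sigma> | \<sigma> permutes {..<N}.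
    Poly_Mapping.single (word_prod s \<sigma> N + g) (of_int (sign \<sigma>) :: 'f::field)) \<subseteq> I"
proof -
  have "\<forall>x h. \<exists>h' n. h \<in> G \<longrightarrow> x + h \<notin> I \<longrightarrow> h' \<in> G \<and> x + h = (\<tau> ^^ n) h'"
    using generates by metis
  then obtain nxt ex where nxt:
    "\<And>x h. h \<in> G \<Longrightarrow> x + h \<notin> I \<Longrightarrow> nxt x h \<in> G \<and> x + h = (\<tau> ^^ ex x h) (nxt x h)"
    by metis
  define X where "X \<sigma> k = word_prod s \<sigma> k + g" for \<sigma> k
  \<comment> \<open>\<open>V\<close> lists the generators reached letter by letter. Its values are
    controlled only while the path avoids \<open>I\<close>, which \<open>good\<close>
    records.\<close>
  define V where "V \<sigma> = rec_nat g (\<lambda>k v. nxt (s (\<sigma> k)) v)" for \<sigma> :: "nat \<Rightarrow> nat"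
  have X_simps: "X \<sigma> 0 = g" "X \<sigma> (Suc k) = s (\<sigma> k) + X \<sigma> k" for \<sigma> k
    by (simp_all add: X_def add.assoc)
  have V_simps: "V \<sigma> 0 = g" "V \<sigma> (Suc k) = nxt (s (\<sigma> k)) (V \<sigma> k)" for \<sigma> k
    by (simp_all add: V_def)
  define good where "good \<sigma> k \<longleftrightarrow> (\<forall>j<k. s (\<sigma> j) + V \<sigma> j \<notin> I)" for \<sigma> k
  define e where "e \<sigma> j = ex (s (\<sigma> j)) (V \<sigma> j)" for \<sigma> j
  have rep: "V \<sigma> k \<in> G \<and> X \<sigma> k = (\<tau> ^^ (\<Sum>j<k. e \<sigma> j)) (V \<sigma> k)" if "good \<sigma> k" for \<sigma> k
    using that
  proof (induction k)
    case (Suc k)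
    then have IH: "V \<sigma> k \<in> G" "X \<sigma> k = (\<tau> ^^ (\<Sum>j<k. e \<sigma> j)) (V \<sigma> k)"
      by (auto simp: good_def)
    then have "X \<sigma> (Suc k) = (\<tau> ^^ (\<Sum>j<k. e \<sigma> j)) (s (\<sigma> k) + V \<sigma> k)"
      by (simp add: X_simps funpow_left)
    moreover have "nxt (s (\<sigma> k)) (V \<sigma> k) \<in> G"
      "s (\<sigma> k) + V \<sigma> k = (\<tau> ^^ e \<sigma> k) (V \<sigma> (Suc k))"
      using nxt[OF IH(1)] Suc.prems by (auto simp: good_def e_def V_simps)
    ultimately show ?case
      by (simp add: V_simps funpow_add)
  qed (use g in \<open>simp add: X_simps V_simps\<close>)
  \<comment> \<open>\<open>I\<close> absorbs left letters and \<open>\<tau>\<close>, so a word with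
    value outside \<open>I\<close> never met \<open>I\<close> on its way.\<close>
  have notI: "X \<sigma> k \<notin> I \<Longrightarrow> good \<sigma> k" for \<sigma> k
  proof (induction k)
    case (Suc k)
    then have "X \<sigma> k \<notin> I"
      using left by (auto simp: X_simps)
    with Suc.IH have k: "good \<sigma> k" by blast
    have "s (\<sigma> k) + V \<sigma> k \<notin> I"
      using Suc.prems rep[OF k] funpow_closed by (auto simp: X_simps funpow_left)
    with k show ?case
      by (auto simp: good_def less_Suc_eq)
  qed (simp add: good_def)
  let ?P = "{\<sigma>. \<sigma> permutes {..<N}}"
  let ?f = "\<lambda>\<sigma>. Poly_Mapping.single (X \<sigma> N) (of_int (sign \<sigma>) :: 'f)"
  let ?path = "\<lambda>\<sigma>. map (V \<sigma>) [0..<Suc N]"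
  have finP: "finite ?P"
    by (simp add: finite_permutations)
  \<comment> \<open>Good permutations are grouped by their path of generators, and each group
    cancels separately.\<close>
  have fiber: "(\<Sum>\<sigma> | \<sigma> \<in> {\<sigma>\<in>?P. good \<sigma> N} \<and> ?path \<sigma> = \<pi>. ?f \<sigma>) = 0" for \<pi>
  proof (cases "{\<sigma>. \<sigma> \<in> {\<sigma>\<in>?P. good \<sigma> N} \<and> ?path \<sigma> = \<pi>} = {}")
    case False
    let ?F = "{\<sigma>. \<sigma> \<in> {\<sigma>\<in>?P. good \<sigma> N} \<and> ?path \<sigma> = \<pi>}"
    from False obtain \<sigma>0 where \<sigma>0: "\<sigma>0 \<in> ?F" by blast
    have V_eq: "V \<sigma> k = \<pi> ! k" if "\<sigma> \<in> ?F" "k \<le> N" for \<sigma> k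
      using that by (auto simp del: upt_Suc)
    have inG: "\<pi> ! k \<in> G" if "k \<le> N" for k
      using rep[of \<sigma>0 k] \<sigma>0 V_eq[OF \<sigma>0 that] that by (auto simp: good_def)
    \<comment> \<open>The path has \<open>N\<close> edges among at most
      \<open>card G * card G\<close> ordered pairs, so an edge recurs.\<close>
    have "(\<lambda>k. (\<pi> ! k, \<pi> ! Suc k)) ` {..<N} \<subseteq> G \<times> G"
      using inG by auto
    then have "card ((\<lambda>k. (\<pi> ! k, \<pi> ! Suc k)) ` {..<N}) \<le> card (G \<times> G)"
      using finite_G by (intro card_mono) auto
    then have "card ((\<lambda>k. (\<pi> ! k, \<pi> ! Suc k)) ` {..<N}) < card {..<N}"
      using N by (simp add: card_cartesian_product)
    then have "\<not> inj_on (\<lambda>k. (\<pi> ! k, \<pi> ! Suc k)) {..<N}"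
      by (rule pigeonhole)
    then obtain p q where pq: "p < N" "q < N" "p \<noteq> q" "\<pi> ! p = \<pi> ! q" "\<pi> ! Suc p = \<pi> ! Suc q"
      unfolding inj_on_def by auto
    let ?t = "transpose p q"
    have t_less: "?t k < N" if "k < N" for k
      using that pq by (auto simp: transpose_def)
    have t_edge: "\<pi> ! ?t k = \<pi> ! k" "\<pi> ! Suc (?t k) = \<pi> ! Suc k" for k
      using pq by (auto simp: transpose_def)
    have perm: "?t permutes {..<N}"
      using pq by (intro permutes_swap_id) auto
    have V_swap: "V (\<sigma> \<circ> ?t) k = \<pi> ! k" if \<sigma>: "\<sigma> \<in> ?F" and "k \<le> N" for \<sigma> k
      using \<open>k \<le> N\<close>
    proof (induction k)
      case (Suc k)
      then have "V (\<sigma> \<circ> ?t) (Suc k) = nxt (s (\<sigma> (?t k))) (V \<sigma> (?t k))"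
        using V_eq[OF \<sigma>, of "?t k"] t_less[of k] by (simp add: V_simps t_edge comp_def)
      also have "\<dots> = \<pi> ! Suc k"
        using V_eq[OF \<sigma>, of "Suc (?t k)"] t_less[of k] Suc.prems by (simp add: V_simps t_edge)
      finally show ?case .
    qed (use V_eq[OF \<sigma>, of 0] in \<open>simp add: V_simps\<close>)
    have V_swap': "V (\<sigma> \<circ> ?t) k = V \<sigma> (?t k)" if "\<sigma> \<in> ?F" "k < N" for \<sigma> k
      using V_swap[OF that(1), of k] V_eq[OF that(1), of "?t k"] that(2) t_less[of k] by (simp add: t_edge)
    have F_swap: "\<sigma> \<circ> ?t \<in> ?F" if \<sigma>: "\<sigma> \<in> ?F" for \<sigma>
    proof -
      have "\<sigma> \<circ> ?t permutes {..<N}"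
        using \<sigma> perm by (auto intro: permutes_compose)
      moreover have "good (\<sigma> \<circ> ?t) N"
        using \<sigma> V_swap'[OF \<sigma>] t_less by (auto simp: good_def)
      moreover have "?path (\<sigma> \<circ> ?t) = \<pi>"
      proof -
        have "?path (\<sigma> \<circ> ?t) = ?path \<sigma>"
          using V_swap[OF \<sigma>] V_eq[OF \<sigma>] by (intro map_cong refl) (auto simp del: upt_Suc)
        then show ?thesis using \<sigma> by (simp only: mem_Collect_eq)
      qed
      ultimately show ?thesis by blast
    qed
    \<comment> \<open>The swap keeps the end point and only permutes the summands of the total
      exponent of \<open>\<tau>\<close>.\<close>
    have X_swap: "X (\<sigma> \<circ> ?t) N = X \<sigma> N" if \<sigma>: "\<sigma> \<in> ?F" for \<sigma>
    proof -
      have "(\<Sum>j<N. e (\<sigma> \<circ> ?t) j) = (\<Sum>j<N. e \<sigma> (?t j))"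
        using V_swap'[OF \<sigma>] by (intro sum.cong) (simp_all add: e_def)
      also have "\<dots> = (\<Sum>j<N. e \<sigma> j)"
        using sum.permute[OF perm, of "e \<sigma>"] by (simp add: comp_def)
      finally show ?thesis
        using rep[of \<sigma> N] rep[of "\<sigma> \<circ> ?t" N] \<sigma> F_swap[OF \<sigma>] V_swap[OF \<sigma>, of N] V_eq[OF \<sigma>, of N] by auto
    qed
    show ?thesis
    proof (rule sum_sign_reversing_eq_0)
      show "finite ?F"
        by (rule finite_subset[OF _ finP]) auto
      show permutation: "permutation \<sigma>" if "\<sigma> \<in> ?F" for \<sigma>
        using that permutation_permutes by blast
      show "?f (\<sigma> \<circ> ?t) = - ?f \<sigma>" if "\<sigma> \<in> ?F" for \<sigma>
        using X_swap[OF that] sign_compose[OF permutation[OF that] permutation_swap_id, of p q] pq(3)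
        by (simp add: sign_swap_id single_uminus)
    qed (use pq F_swap in auto)
  qed (simp only: sum.empty)
  have "sum ?f {\<sigma>\<in>?P. good \<sigma> N} =
      (\<Sum>\<pi>\<in>?path ` {\<sigma>\<in>?P. good \<sigma> N}. \<Sum>\<sigma> | \<sigma> \<in> {\<sigma>\<in>?P. good \<sigma> N} \<and> ?path \<sigma> = \<pi>. ?f \<sigma>)"
    using finP by (intro sum.image_gen) auto
  also have "\<dots> = 0"
    by (intro sum.neutral ballI fiber)
  finally have "sum ?f {\<sigma>\<in>?P. good \<sigma> N} = 0" .
  moreover have "sum ?f ?P = sum ?f {\<sigma>\<in>?P. good \<sigma> N} + sum ?f {\<sigma>\<in>?P. \<not> good \<sigma> N}"
    using finP by (subst sum.union_disjoint[symmetric]) (auto intro: sum.cong)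
  \<comment> \<open>Only permutations that are not good survive, and by \<open>notI\<close> their
    words lie in \<open>I\<close>.\<close>
  ultimately have "sum ?f ?P = sum ?f {\<sigma>\<in>?P. \<not> good \<sigma> N}"
    by simp
  moreover have "Poly_Mapping.keys (sum ?f {\<sigma>\<in>?P. \<not> good \<sigma> N}) \<subseteq> I"
    using keys_sum[of ?f "{\<sigma>\<in>?P. \<not> good \<sigma> N}"] notI by (fastforce split: if_splits)
  ultimately show ?thesis
    by (simp add: X_def)
qed

end

section \<open>Evaluation as an algebra homomorphism\<close>

lemma update_conv_add_single:
  assumes "a \<notin> Poly_Mapping.keys f"
  shows "Poly_Mapping.update a b f = f + Poly_Mapping.single a b"
  using assms
  by (auto simp: poly_mapping_eq_iff fun_eq_iff lookup_update lookup_add lookup_single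
      in_keys_iff when_def)

text \<open>Reduces additive statements to monomials; zero is covered as a monomial with coefficient
  0.\<close>

lemma poly_mapping_add_induct [case_names single add]:
  assumes single: "\<And>k v. P (Poly_Mapping.single k v)"
    and add: "\<And>f g. P f \<Longrightarrow> P g \<Longrightarrow> P (f + g)"
  shows "P (f :: 'a \<Rightarrow>\<^sub>0 'b::comm_monoid_add)"
proof (induction f rule: update_induct)
  case const
  then show ?case using single[of undefined 0] by simp
next
  case (update f a b)
  have "Poly_Mapping.update a b f = f + Poly_Mapping.single a b"
    using update.hyps(1) by (rule update_conv_add_single)
  then show ?case
    using add[OF update.IH single] by simp
qed

context assoc_algebra
begin

text \<open>Allows polynomials with different supports to be summed over a common index set.\<close>

lemma nc_eval_superset:
  assumes "finite K" "Poly_Mapping.keys p \<subseteq> K"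
  shows "nc_eval scale r p = (\<Sum>w\<in>K. scale (Poly_Mapping.lookup p w) (prod_list (map r (letters w))))"
  unfolding nc_eval_def using assms by (intro sum.mono_neutral_left) (auto simp: in_keys_iff)

lemma nc_eval_add: "nc_eval scale r (p + q) = nc_eval scale r p + nc_eval scale r q"
proof -
  let ?K = "Poly_Mapping.keys p \<union> Poly_Mapping.keys q"
  have K: "finite ?K" "Poly_Mapping.keys (p + q) \<subseteq> ?K"
    using Poly_Mapping.keys_add[of p q] by auto
  have K': "Poly_Mapping.keys p \<subseteq> ?K" "Poly_Mapping.keys q \<subseteq> ?K"
    by auto
  show ?thesis
    unfolding nc_eval_superset[OF K] nc_eval_superset[OF K(1) K'(1)] nc_eval_superset[OF K(1) K'(2)]
    by (simp add: lookup_add scale_left_distrib sum.distrib)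
qed

lemma nc_eval_single:
  "nc_eval scale r (Poly_Mapping.single w c) = scale c (prod_list (map r (letters w)))"
  by (simp add: nc_eval_def)

lemma nc_eval_sum: "nc_eval scale r (\<Sum>x\<in>X. f x) = (\<Sum>x\<in>X. nc_eval scale r (f x))"
  by (induction X rule: infinite_finite_induct) (simp_all add: nc_eval_add, simp_all add: nc_eval_def)

lemma nc_eval_mult: "nc_eval scale r (p * q) = nc_eval scale r p * nc_eval scale r q"
proof (induction p rule: poly_mapping_add_induct)
  case (single w c)
  show ?case
  proof (induction q rule: poly_mapping_add_induct)
    case (single v d)
    then show ?case
      by (simp add: mult_single nc_eval_single plus_free_monoid_def scale_mult_left scale_mult_right)
  next
    case (add f g)
    then show ?case by (simp add: distrib_left nc_eval_add)
  qed
next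
  case (add f g)
  then show ?case by (simp add: distrib_right nc_eval_add)
qed

end

section \<open>Standard polynomials in the free algebra\<close>

lemma free_algebra_mono: "m \<le> n \<Longrightarrow> free_algebra m \<subseteq> free_algebra n"
  unfolding free_algebra_def by fastforce

lemma free_algebra_mult:
  assumes "p \<in> free_algebra n" "q \<in> free_algebra n"
  shows "p * q \<in> free_algebra n"
proof -
  have "set (letters w) \<subseteq> {1..n}" if w: "w \<in> Poly_Mapping.keys (p * q)" for w
  proof -
    obtain u v where "u \<in> Poly_Mapping.keys p" "v \<in> Poly_Mapping.keys q" "w = u + v"
      using keys_mult[of p q] w by blast
    with assms show ?thesis
      by (auto simp: free_algebra_def plus_free_monoid_def)
  qed
  then show ?thesis by (simp add: free_algebra_def)
qed

text \<open>Indeterminates start at 1 while permutations act on \<open>{..<N}\<close>, hence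
  \<open>Suc\<close>; the reversed order agrees with \<open>word_prod\<close>.\<close>

definition perm_word :: "nat \<Rightarrow> (nat \<Rightarrow> nat) \<Rightarrow> nat free_monoid" where
  "perm_word N \<sigma> = Word (map (\<lambda>j. Suc (\<sigma> j)) (rev [0..<N]))"

text \<open>The classical standard polynomial up to a global sign, which comes from reversing the
  words.\<close>

definition standard_poly :: "nat \<Rightarrow> 'f::field nc_poly" where
  "standard_poly N =
    (\<Sum>\<sigma> | \<sigma> permutes {..<N}. Poly_Mapping.single (perm_word N \<sigma>) (of_int (sign \<sigma>)))"

lemma perm_word_inject:
  assumes "\<sigma> permutes {..<N}" "\<rho> permutes {..<N}" "perm_word N \<sigma> = perm_word N \<rho>"
  shows "\<sigma> = \<rho>"
proof
  fix j
  show "\<sigma> j = \<rho> j"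
    using assms by (cases "j < N") (auto simp: perm_word_def permutes_def)
qed

lemma standard_poly_in_free_algebra: "standard_poly N \<in> free_algebra N"
proof -
  have "set (letters w) \<subseteq> {1..N}" if w: "w \<in> Poly_Mapping.keys (standard_poly N :: 'a nc_poly)" for w
  proof -
    obtain \<sigma> where \<sigma>: "\<sigma> permutes {..<N}"
      "w \<in> Poly_Mapping.keys (Poly_Mapping.single (perm_word N \<sigma>) (of_int (sign \<sigma>) :: 'a))"
      using subsetD[OF keys_sum w[unfolded standard_poly_def]] by blast
    then have "w = perm_word N \<sigma>"
      by (simp split: if_splits)
    moreover have "Suc (\<sigma> j) \<le> N" if "j < N" for j
      using permutes_in_image[OF \<sigma>(1), of j] that by simp
    ultimately show ?thesis
      by (auto simp: perm_word_def)
  qed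
  then show ?thesis by (simp add: free_algebra_def)
qed

text \<open>In a free monoid, equal words with prefixes of equal length have equal prefixes and
  equal remainders.\<close>

lemma lookup_single_word_mult:
  assumes "length (letters w) = length (letters u)"
  shows "Poly_Mapping.lookup (Poly_Mapping.single w c * p) (u + v) =
    (if w = u then c * Poly_Mapping.lookup p v else (0 :: 'f::field))"
proof (induction p rule: poly_mapping_add_induct)
  case (single x d)
  have "w + x = u + v \<longleftrightarrow> w = u \<and> x = v"
    using assms by (cases w; cases u; cases x; cases v) (simp add: plus_free_monoid_def)
  then show ?case
    by (auto simp: mult_single lookup_single when_def)
next
  case (add f g)
  then show ?case by (simp add: distrib_left lookup_add)
qed

text \<open>All words of the standard polynomial have length \<open>N\<close>, so the coefficient at
  the identity word followed by \<open>v\<close> receives a contribution from the identity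
  alone.\<close>

lemma standard_poly_mult_nonzero:
  fixes p :: "'f::field nc_poly"
  assumes "p \<noteq> 0"
  shows "standard_poly N * p \<noteq> 0"
proof -
  obtain v where v: "Poly_Mapping.lookup p v \<noteq> 0"
    using assms by (metis lookup_zero poly_mapping_eqI)
  have "Poly_Mapping.lookup (standard_poly N * p) (perm_word N id + v) =
      (\<Sum>\<sigma> | \<sigma> permutes {..<N}. if \<sigma> = id then Poly_Mapping.lookup p v else 0)"
    unfolding standard_poly_def sum_distrib_right lookup_sum
  proof (intro sum.cong refl)
    fix \<sigma> assume "\<sigma> \<in> {\<sigma>. \<sigma> permutes {..<N}}"
    then have "perm_word N \<sigma> = perm_word N id \<longleftrightarrow> \<sigma> = id"
      using perm_word_inject[of \<sigma> N id] by (auto simp: permutes_id)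
    moreover have "length (letters (perm_word N \<sigma>)) = length (letters (perm_word N id))"
      by (simp add: perm_word_def)
    ultimately show "Poly_Mapping.lookup (Poly_Mapping.single (perm_word N \<sigma>) (of_int (sign \<sigma>)) * p)
        (perm_word N id + v) = (if \<sigma> = id then Poly_Mapping.lookup p v else 0)"
      by (subst lookup_single_word_mult) (auto simp: sign_id)
  qed
  also have "\<dots> = Poly_Mapping.lookup p v"
    by (simp add: finite_permutations permutes_id)
  finally show ?thesis
    using v by auto
qed

section \<open>Multilinearity and reduction to monomials\<close>

lemma prod_list_fun_upd_add:
  fixes r :: "nat \<Rightarrow> 'r::ring_1"
  assumes "distinct xs" "a \<in> set xs"
  shows "prod_list (map (r(a := x + y)) xs) = prod_list (map (r(a := x)) xs) + prod_list (map (r(a := y)) xs)"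
proof -
  obtain us vs where xs: "xs = us @ a # vs"
    using assms(2) by (meson split_list)
  then have [simp]: "map (r(a := z)) us = map r us" "map (r(a := z)) vs = map r vs" for z
    using assms(1) by auto
  show ?thesis
    by (simp add: xs algebra_simps)
qed

lemma keys_ma_scale_subset: "Poly_Mapping.keys (ma_scale c p) \<subseteq> Poly_Mapping.keys p"
  by (auto simp: in_keys_iff lookup_ma_scale)

lemma ma_scale_single: "ma_scale c (Poly_Mapping.single k v) = Poly_Mapping.single k (c * v)"
  by (simp add: ma_scale_conv_mult mult_single)

interpretation ma: assoc_algebra "ma_scale :: 'f::field \<Rightarrow> ('m::monoid_add, 'f) monoid_algebra \<Rightarrow> _"
  by (rule assoc_algebra_ma_scale)

lemma nc_eval_standard_poly:
  "nc_eval ma_scale r (standard_poly N) =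
    (\<Sum>\<sigma> | \<sigma> permutes {..<N}. ma_scale (of_int (sign \<sigma>)) (prod_list (map r (letters (perm_word N \<sigma>)))))"
  by (simp add: standard_poly_def ma.nc_eval_sum ma.nc_eval_single)

text \<open>Each indeterminate occurs exactly once in each word.\<close>

lemma nc_eval_standard_poly_add:
  assumes "m < N"
  shows "nc_eval ma_scale (r(Suc m := x + y)) (standard_poly N) =
    nc_eval ma_scale (r(Suc m := x)) (standard_poly N) + nc_eval ma_scale (r(Suc m := y)) (standard_poly N)"
proof -
  have "prod_list (map (r(Suc m := x + y)) (letters (perm_word N \<sigma>))) =
      prod_list (map (r(Suc m := x)) (letters (perm_word N \<sigma>))) +
      prod_list (map (r(Suc m := y)) (letters (perm_word N \<sigma>)))" if \<sigma>: "\<sigma> permutes {..<N}" for \<sigma>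
  proof (rule prod_list_fun_upd_add)
    show "distinct (letters (perm_word N \<sigma>))"
      using permutes_inj_on[OF \<sigma>, of "{0..<N}"] by (auto simp: perm_word_def distinct_map inj_on_def)
    have "m \<in> \<sigma> ` {..<N}"
      using permutes_image[OF \<sigma>] assms by simp
    then show "Suc m \<in> set (letters (perm_word N \<sigma>))"
      by (auto simp: perm_word_def)
  qed
  then show ?thesis
    by (simp add: nc_eval_standard_poly ma.scale_right_distrib sum.distrib)
qed

text \<open>The coefficients commute, so their product is the same for every permutation and can be
  factored out.\<close>

lemma prod_list_perm_word_singles:
  assumes r: "\<And>j. j < N \<Longrightarrow> r (Suc j) = Poly_Mapping.single (s j) (c j :: 'f::field)"
    and \<sigma>: "\<sigma> permutes {..<N}"
  shows "prod_list (map r (letters (perm_word N \<sigma>))) =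
    Poly_Mapping.single (word_prod s \<sigma> N) (\<Prod>j<N. c j)"
proof -
  have "prod_list (map r (map (\<lambda>j. Suc (\<sigma> j)) (rev [0..<k]))) =
      Poly_Mapping.single (word_prod s \<sigma> k) (\<Prod>j<k. c (\<sigma> j))" if "k \<le> N" for k
    using that
  proof (induction k)
    case (Suc k)
    then have "\<sigma> k < N"
      using permutes_in_image[OF \<sigma>, of k] by simp
    with Suc show ?case
      by (simp add: r mult_single mult.commute)
  qed simp
  moreover have "(\<Prod>j<N. c (\<sigma> j)) = (\<Prod>j<N. c j)"
    using prod.permute[OF \<sigma>, of c] by (simp add: comp_def)
  ultimately show ?thesis
    by (simp add: perm_word_def)
qed

context act_generators
begin

lemma standard_poly_singles:
  fixes r :: "nat \<Rightarrow> ('m, 'f::field) monoid_algebra"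
  assumes r: "\<And>j. j < N \<Longrightarrow> \<exists>s c. r (Suc j) = Poly_Mapping.single s c"
    and g: "g \<in> G" and N: "card G * card G < N"
  shows "Poly_Mapping.keys (nc_eval ma_scale r (standard_poly N) * Poly_Mapping.single g 1) \<subseteq> I"
proof -
  obtain s c where sc: "\<And>j. j < N \<Longrightarrow> r (Suc j) = Poly_Mapping.single (s j) (c j)"
    using r by metis
  have "nc_eval ma_scale r (standard_poly N) * Poly_Mapping.single g 1 =
      (\<Sum>\<sigma> | \<sigma> permutes {..<N}. ma_scale (\<Prod>j<N. c j)
        (Poly_Mapping.single (word_prod s \<sigma> N + g) (of_int (sign \<sigma>))))"
    unfolding nc_eval_standard_poly sum_distrib_right
    by (intro sum.cong refl)
      (simp only: mem_Collect_eq prod_list_perm_word_singles[of N r s c, OF sc] ma_scale_single mult_single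
        mult_1_right mult.commute[of _ "\<Prod>j<N. c j"])
  also have "\<dots> = ma_scale (\<Prod>j<N. c j) (\<Sum>\<sigma> | \<sigma> permutes {..<N}.
        Poly_Mapping.single (word_prod s \<sigma> N + g) (of_int (sign \<sigma>)))"
    by (simp add: ma.scale_sum_right)
  finally show ?thesis
    using keys_ma_scale_subset alternating_sum_words[OF g N, of s] by fastforce
qed

lemma standard_poly_generator:
  fixes r :: "nat \<Rightarrow> ('m, 'f::field) monoid_algebra"
  assumes g: "g \<in> G" and N: "card G * card G < N"
  shows "Poly_Mapping.keys (nc_eval ma_scale r (standard_poly N) * Poly_Mapping.single g 1) \<subseteq> I"
proof -
  let ?\<Phi> = "\<lambda>r :: nat \<Rightarrow> ('m, 'f) monoid_algebra. nc_eval ma_scale r (standard_poly N) * Poly_Mapping.single g 1"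
  \<comment> \<open>Induction on the number \<open>m\<close> of leading arguments that are still
    arbitrary; the others are monomials, and multilinearity releases one argument at a time.\<close>
  have "Poly_Mapping.keys (?\<Phi> r) \<subseteq> I"
    if "m \<le> N" "\<And>j. m \<le> j \<Longrightarrow> j < N \<Longrightarrow> \<exists>s c. r (Suc j) = Poly_Mapping.single s c" for m r
    using that
  proof (induction m arbitrary: r)
    case 0
    then show ?case by (intro standard_poly_singles g N) auto
  next
    case (Suc m)
    define \<Psi> where "\<Psi> x = ?\<Phi> (r(Suc m := x))" for x
    have \<Psi>_add: "\<Psi> (x + y) = \<Psi> x + \<Psi> y" for x y
      using nc_eval_standard_poly_add[of m N r x y] Suc.prems(1) by (simp add: \<Psi>_def distrib_right)
    have "Poly_Mapping.keys (\<Psi> x) \<subseteq> I" for x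
    proof (induction x rule: poly_mapping_add_induct)
      case (single s c)
      have "\<exists>s' c'. (r(Suc m := Poly_Mapping.single s c)) (Suc j) = Poly_Mapping.single s' c'"
        if "m \<le> j" "j < N" for j
        using Suc.prems(2)[of j] that by (cases "j = m") auto
      then show ?case
        unfolding \<Psi>_def using Suc.prems(1) by (intro Suc.IH) auto
    next
      case (add x y)
      then show ?case
        using Poly_Mapping.keys_add[of "\<Psi> x" "\<Psi> y"] by (auto simp: \<Psi>_add)
    qed
    from this[of "r (Suc m)"] show ?case by (simp add: \<Psi>_def)
  qed
  from this[of N r] show ?thesis by simp
qed

end

subsection \<open>Descent through ideals\<close>

text \<open>Used to show that a standard polynomial value carries the span of one ideal into another
  by testing basis elements.\<close>

lemma keys_mult_subset_by_singles:
  assumes "\<And>k. k \<in> Poly_Mapping.keys q \<Longrightarrow> Poly_Mapping.keys (p * Poly_Mapping.single k 1) \<subseteq> J"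
  shows "Poly_Mapping.keys (p * (q :: ('m::monoid_add, 'f::field) monoid_algebra)) \<subseteq> J"
  using assms
proof (induction q rule: update_induct)
  case (update q k c)
  have "Poly_Mapping.update k c q = q + Poly_Mapping.single k c"
    using update.hyps(1) by (rule update_conv_add_single)
  moreover have "p * Poly_Mapping.single k c = ma_scale c (p * Poly_Mapping.single k 1)"
    by (simp add: ma_scale_conv_mult_right mult.assoc mult_single)
  moreover have "Poly_Mapping.keys (p * Poly_Mapping.single k 1) \<subseteq> J"
    "Poly_Mapping.keys (p * q) \<subseteq> J"
    using update by (auto simp: keys_update)
  ultimately show ?case
    using Poly_Mapping.keys_add[of "p * q" "p * Poly_Mapping.single k c"]
      keys_ma_scale_subset[of c "p * Poly_Mapping.single k 1"]
    by (auto simp: distrib_left)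
qed simp

lemma keys_mult_single_right:
  fixes p :: "('m::monoid_add, 'f::field) monoid_algebra"
  assumes p: "Poly_Mapping.keys (p * Poly_Mapping.single k 1) \<subseteq> J"
    and J: "\<And>x. x \<in> J \<Longrightarrow> x + y \<in> J"
  shows "Poly_Mapping.keys (p * Poly_Mapping.single (k + y) 1) \<subseteq> J"
proof -
  have "p * Poly_Mapping.single (k + y) 1 = (p * Poly_Mapping.single k 1) * Poly_Mapping.single y 1"
    by (simp add: mult.assoc mult_single)
  then show ?thesis
    using keys_mult[of "p * Poly_Mapping.single k 1" "Poly_Mapping.single y 1"] p J by fastforce
qed

section \<open>Ideals in the monoid with unit and the induction over them\<close>

lemma Elem_left_ideal: "left_ideal I \<Longrightarrow> x \<in> Elem ` I \<Longrightarrow> s + x \<in> Elem ` I"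
  by (cases s) (auto simp: left_ideal_def)

lemma Elem_right_ideal: "right_ideal I \<Longrightarrow> x \<in> Elem ` I \<Longrightarrow> x + s \<in> Elem ` I"
  by (cases s) (auto simp: right_ideal_def)

lemma funpow_Elem: "((\<lambda>x. x + Elem t) ^^ n) (Elem g) = Elem (((\<lambda>x. x * t) ^^ n) g)"
  by (induction n) simp_all

context monogenic_union
begin

text \<open>The finite complement of \<open>I\<close> serves as generating set with
  \<open>\<tau>\<close> the identity. Including \<open>Unit\<close> makes the standard polynomial
  applied to that generator its own value.\<close>

lemma PI_modulo_ideal_cofinite:
  fixes I :: "'s set"
  assumes I: "left_ideal I" and "radical I = UNIV"
  shows "\<exists>n\<ge>1. \<exists>p \<in> free_algebra n. p \<noteq> 0 \<and>
    (\<forall>r :: nat \<Rightarrow> ('s with_unit, 'f::field) monoid_algebra.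
      Poly_Mapping.keys (nc_eval ma_scale r p) \<subseteq> Elem ` I)"
proof -
  define G where "G = insert Unit (Elem ` (- I))"
  have "finite (- I)"
    using finite_radical_diff[OF I] assms(2) by (simp add: Compl_eq_Diff_UNIV)
  then interpret act_generators "Elem ` I" G id
  proof unfold_locales
    fix g s :: "'s with_unit"
    have "s + g \<in> Elem ` I \<or> s + g \<in> G"
      by (cases "s + g") (auto simp: G_def)
    then show "s + g \<in> Elem ` I \<or> (\<exists>h\<in>G. \<exists>n. s + g = (id ^^ n) h)"
      by auto
  qed (auto simp: G_def Elem_left_ideal[OF I])
  define N where "N = Suc (card G * card G)"
  have "Poly_Mapping.keys (nc_eval ma_scale r (standard_poly N)) \<subseteq> Elem ` I"
    for r :: "nat \<Rightarrow> ('s with_unit, 'f) monoid_algebra"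
    using standard_poly_generator[of Unit N r]
    by (simp add: G_def N_def single_one flip: zero_with_unit_def)
  moreover have "standard_poly N \<noteq> (0 :: 'f nc_poly)"
    using standard_poly_mult_nonzero[of 1 N] by simp
  ultimately show ?thesis
    using standard_poly_in_free_algebra[of N] by (intro exI[of _ N]) (auto simp: N_def)
qed

text \<open>The measure counts the generators without a power in \<open>I\<close>; passing from
  \<open>I\<close> to \<open>J\<close> lowers it.\<close>

lemma PI_modulo_ideal:
  fixes I :: "'s set"
  assumes "left_ideal I" "right_ideal I"
  shows "\<exists>n\<ge>1. \<exists>p \<in> free_algebra n. p \<noteq> 0 \<and>
    (\<forall>r :: nat \<Rightarrow> ('s with_unit, 'f::field) monoid_algebra.
      Poly_Mapping.keys (nc_eval ma_scale r p) \<subseteq> Elem ` I)"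
  using assms
proof (induction "card (A - radical I)" arbitrary: I rule: less_induct)
  case less
  note lI = less.prems(1) and rI = less.prems(2)
  show ?case
  proof (cases "radical I = UNIV")
    case True
    with lI show ?thesis by (rule PI_modulo_ideal_cofinite)
  next
    case False
    then obtain t G where t: "t \<notin> radical I" and G: "finite G" "G \<subseteq> I \<union> left_multiples t"
      and gen: "\<And>u. u \<in> left_multiples t \<Longrightarrow> u \<in> I \<or> (\<exists>g\<in>G. \<exists>n. u = ((\<lambda>x. x * t) ^^ n) g)"
      using finitely_generated_right_act[OF lI rI] by metis
    let ?\<tau> = "\<lambda>x. x + Elem t"
    have gen': "Elem u \<in> Elem ` I \<or> (\<exists>h\<in>Elem ` G. \<exists>n. Elem u = (?\<tau> ^^ n) h)"
      if "u \<in> I \<union> left_multiples t" for u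
      using gen[of u] that by (auto simp: funpow_Elem)
    interpret act_generators "Elem ` I" "Elem ` G" ?\<tau>
    proof unfold_locales
      fix g s :: "'s with_unit" assume "g \<in> Elem ` G"
      then obtain x where x: "g = Elem x" "x \<in> G" by blast
      show "s + g \<in> Elem ` I \<or> (\<exists>h\<in>Elem ` G. \<exists>n. s + g = (?\<tau> ^^ n) h)"
      proof (cases s)
        case Unit
        then show ?thesis using gen'[of x] x G by auto
      next
        case (Elem a)
        have "a * x \<in> I \<union> left_multiples t"
          using left_ideal_Un_left_multiples[OF lI, of t] x(2) G by (auto simp: left_ideal_def)
        then show ?thesis using gen'[of "a * x"] x Elem by simp
      qed
    qed (use G in \<open>simp_all add: Elem_left_ideal[OF lI] Elem_right_ideal[OF rI] add.assoc\<close>)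
    define N where "N = Suc (card (Elem ` G) * card (Elem ` G))"
    \<comment> \<open>The two-sided ideal \<open>I\<close> together with S^1 t S^1, split according
      to whether a right factor is present.\<close>
    define J where "J = I \<union> left_multiples t \<union> {u * y |u y. u \<in> left_multiples t}"
    have lJ: "left_ideal J"
      unfolding left_ideal_def
    proof (intro allI ballI)
      fix s x assume "x \<in> J"
      then consider "x \<in> I" | "x \<in> left_multiples t" | u y where "x = u * y" "u \<in> left_multiples t"
        by (auto simp: J_def)
      then show "s * x \<in> J"
      proof cases
        case 3
        then have "s * x = (s * u) * y" "s * u \<in> left_multiples t"
          by (simp_all add: mult.assoc left_multiples_mult)
        then show ?thesis unfolding J_def by blast
      qed (use lI in \<open>auto simp: J_def left_ideal_def left_multiples_mult\<close>)
    qed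
    have rJ: "right_ideal J"
      using rI unfolding J_def right_ideal_def by (auto simp: mult.assoc) blast
    have "t \<in> J"
      by (simp add: J_def self_in_left_multiples)
    \<comment> \<open>The generator of the piece containing \<open>t\<close> enters the radical of
      \<open>J\<close> but was not in that of \<open>I\<close>.\<close>
    obtain a where a: "a \<in> A" "t \<in> monogenic a"
      using cover by blast
    have "a \<in> radical J" "a \<notin> radical I"
      using radical_iff[OF lJ a(2)] radical_iff[OF lI a(2)] t \<open>t \<in> J\<close> subset_radical by auto
    moreover have "radical I \<subseteq> radical J"
      by (rule radical_mono) (auto simp: J_def)
    ultimately have "A - radical J \<subset> A - radical I"
      using a(1) by blast
    then have "card (A - radical J) < card (A - radical I)"
      using finite_generators by (intro psubset_card_mono) auto
    from less.hyps[OF this lJ rJ] obtain n and p :: "'f nc_poly" where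
      p: "n \<ge> 1" "p \<in> free_algebra n" "p \<noteq> 0"
        "\<And>r :: nat \<Rightarrow> ('s with_unit, 'f) monoid_algebra.
          Poly_Mapping.keys (nc_eval ma_scale r p) \<subseteq> Elem ` J"
      by blast
    \<comment> \<open>The right factor \<open>p\<close> takes values in the span of
      \<open>J\<close>. The left factor sends it into the span of \<open>I\<close>: first on
      generators, then on their \<open>?\<tau>\<close>-iterates, then on right multiples.\<close>
    have "Poly_Mapping.keys (nc_eval ma_scale r (standard_poly N * p)) \<subseteq> Elem ` I"
      for r :: "nat \<Rightarrow> ('s with_unit, 'f) monoid_algebra"
    proof -
      let ?s = "nc_eval ma_scale r (standard_poly N)"
      have in_I: "Poly_Mapping.keys (?s * Poly_Mapping.single (Elem x) 1) \<subseteq> Elem ` I" if "x \<in> I" for x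
      proof -
        have "Poly_Mapping.keys (?s * Poly_Mapping.single (Elem x) 1) \<subseteq>
            {k + l |k l. k \<in> Poly_Mapping.keys ?s \<and> l = Elem x}"
          using keys_mult[of ?s "Poly_Mapping.single (Elem x) 1"] by auto
        then show ?thesis
          using Elem_left_ideal[OF lI, of "Elem x"] that by blast
      qed
      have act: "Poly_Mapping.keys (?s * Poly_Mapping.single ((?\<tau> ^^ m) h) 1) \<subseteq> Elem ` I"
        if "h \<in> Elem ` G" for h m
      proof (induction m)
        case 0
        then show ?case using standard_poly_generator[OF that, of N r] by (simp add: N_def)
      next
        case (Suc m)
        then show ?case using keys_mult_single_right[OF Suc Elem_right_ideal[OF rI]] by simp
      qed
      have mult: "Poly_Mapping.keys (?s * Poly_Mapping.single (Elem u) 1) \<subseteq> Elem ` I"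
        if "u \<in> left_multiples t" for u
      proof -
        from gen'[of u] that consider "u \<in> I" | h m where "h \<in> Elem ` G" "Elem u = (?\<tau> ^^ m) h"
          by blast
        then show ?thesis
        proof cases
          case 1
          then show ?thesis by (rule in_I)
        next
          case 2
          show ?thesis unfolding 2(2) by (rule act[OF 2(1)])
        qed
      qed
      have mult_right: "Poly_Mapping.keys (?s * Poly_Mapping.single (Elem (u * y)) 1) \<subseteq> Elem ` I"
        if "u \<in> left_multiples t" for u y
        using keys_mult_single_right[OF mult[OF that] Elem_right_ideal[OF rI], of "Elem y"] by simp
      have killed: "Poly_Mapping.keys (?s * Poly_Mapping.single k 1) \<subseteq> Elem ` I" if "k \<in> Elem ` J" for k
      proof -
        from that consider x where "k = Elem x" "x \<in> I" | x where "k = Elem x" "x \<in> left_multiples t"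
          | u y where "k = Elem (u * y)" "u \<in> left_multiples t"
          by (auto simp: J_def)
        then show ?thesis
          by cases (simp_all only: in_I mult mult_right)
      qed
      show ?thesis
        unfolding ma.nc_eval_mult
        by (rule keys_mult_subset_by_singles, rule killed, rule subsetD[OF p(4)])
    qed
    moreover have "standard_poly N * p \<noteq> 0"
      using p(3) by (rule standard_poly_mult_nonzero)
    moreover have "standard_poly N * p \<in> free_algebra (max N n)"
      using standard_poly_in_free_algebra[of N] p(2) free_algebra_mono[of N "max N n"]
        free_algebra_mono[of n "max N n"] by (intro free_algebra_mult) auto
    ultimately show ?thesis
      using p(1) by (intro exI[of _ "max N n"]) auto
  qed
qed

end

theorem corollary2p11:
  fixes A :: "'s::semigroup_mult set"
  assumes "finite A"
    and "(\<Union>a\<in>A. monogenic a) = (UNIV :: 's set)"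
    and "disjoint_family_on monogenic A"
    and "\<And>a. a \<in> A \<Longrightarrow> subsemigroup (monogenic a)"
    and "\<And>a. a \<in> A \<Longrightarrow> iso_positive_integers (monogenic a)"
  shows "PI_algebra (ma_scale :: 'f::field \<Rightarrow> ('s with_unit, 'f) monoid_algebra \<Rightarrow> ('s with_unit, 'f) monoid_algebra)"
proof -
  interpret monogenic_union A
    by unfold_locales (use assms spower_inject in blast)+
  \<comment> \<open>For the empty ideal, having all keys in it means that the value is zero.\<close>
  have "left_ideal ({} :: 's set)" "right_ideal ({} :: 's set)"
    by (simp_all add: left_ideal_def right_ideal_def)
  from PI_modulo_ideal[OF this] show ?thesis
    using assoc_algebra_ma_scale by (auto simp: PI_algebra_def)
qed

end
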